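(* Let $\beta\in(1,2)$ and $\alpha\in(0,2-\beta)$, and let $p=(1-\alpha)/\beta$. The intermediate $\beta$-shift $\Omega_{\beta,\alpha}$ is a subshift of finite type if and only if both of the infinite words $\tau^{+}_{\beta,\alpha}(p)$ and $\tau^{-}_{\beta,\alpha}(p)$ are periodic.
   Context: For $\beta\in(1,2)$, $0\le\alpha\le2-\beta$ and $p=(1-\alpha)/\beta$, the maps $T^{\pm}_{\beta,\alpha}:[0,1]\to[0,1]$ ($x\mapsto\beta x+\alpha \bmod 1$) are: $T^{+}_{\beta,\alpha}(x)=\beta x+\alpha$ if $x<p$ and $\beta x+\alpha-1$ if $x\ge p$; $T^{-}_{\beta,\alpha}(x)=\beta x+\alpha$ if $x\le p$ and $\beta x+\alpha-1$ if $x>p$. The expansion $\tau^{+}_{\beta,\alpha}(x)=(\omega_1,\omega_2,\dots)\in\{0,1\}^{\mathbb{N}}$ has $\omega_n=0$ if $(T^{+}_{\beta,\alpha})^{n-1}(x)<p$ and $\omega_n=1$ otherwise; $\tau^{-}_{\beta,\alpha}(x)$ has $\omega_n=0$ if $(T^{-}_{\beta,\alpha})^{n-1}(x)\le p$ and $\omega_n=1$ otherwise. Set $\Omega^{+}_{\beta,\alpha}=\tau^{+}_{\beta,\alpha}([0,1))$, $\Omega^{-}_{\beta,\alpha}=\tau^{-}_{\beta,\alpha}((0,1])$ and $\Omega_{\beta,\alpha}=\Omega^{+}_{\beta,\alpha}\cup\Omega^{-}_{\beta,\alpha}$. A word $\omega\in\{0,1\}^{\mathbb{N}}$ is periodic if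 there is $n\in\mathbb{N}$, $n\geq 1$, with $\omega_{i+n}=\omega_i$ for all $i\ge1$ (purely periodic). $\{0,1\}^{\mathbb{N}}$ carries the product topology and $\sigma$ is the left shift. A subshift is a closed set $\Omega\subseteq\{0,1\}^{\mathbb{N}}$ with $\sigma(\Omega)\subseteq\Omega$. $\Omega|^{*}$ denotes the set of all finite non-empty words that are prefixes of elements of $\Omega$. A subshift $\Omega$ is a subshift of finite type if there is $M\in\mathbb{N}$ such that for all $(\omega_1,\dots,\omega_n),(\xi_1,\dots,\xi_m)\in\Omega|^{*}$ with $n\ge M$: $(\omega_{n-M+1},\dots,\omega_n,\xi_1,\dots,\xi_m)\in\Omega|^{*}$ if and only if $(\omega_1,\dots,\omega_n,\xi_1,\dots,\xi_m)\in\Omega|^{*}$. *)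

theory Defs
  imports "HOL-Analysis.Analysis"
begin

text \<open>Infinite words are functions on \<open>nat\<close> with values in \<open>{0, 1}\<close>. They are indexed from
  \<open>0\<close>: the value at \<open>i\<close> is the letter \<open>\<omega>\<^sub>i\<^sub>+\<^sub>1\<close> of \<open>\<omega> = (\<omega>\<^sub>1, \<omega>\<^sub>2, \<dots>)\<close>.\<close>

definition crit_pt :: "real \<Rightarrow> real \<Rightarrow> real" where
  "crit_pt \<beta> \<alpha> = (1 - \<alpha>) / \<beta>"

text \<open>The two maps are written down on all of \<open>real\<close>; for \<open>1 < \<beta> < 2\<close> and \<open>0 \<le> \<alpha> \<le> 2 - \<beta>\<close> they map
  the unit interval to itself, and only their values there are ever used.\<close>

definition T_plus :: "real \<Rightarrow> real \<Rightarrow> real \<Rightarrow> real" where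
  "T_plus \<beta> \<alpha> x = (if x < crit_pt \<beta> \<alpha> then \<beta> * x + \<alpha> else \<beta> * x + \<alpha> - 1)"

definition T_minus :: "real \<Rightarrow> real \<Rightarrow> real \<Rightarrow> real" where
  "T_minus \<beta> \<alpha> x = (if x \<le> crit_pt \<beta> \<alpha> then \<beta> * x + \<alpha> else \<beta> * x + \<alpha> - 1)"

definition tau_plus :: "real \<Rightarrow> real \<Rightarrow> real \<Rightarrow> nat \<Rightarrow> nat" where
  "tau_plus \<beta> \<alpha> x = (\<lambda>i. if (T_plus \<beta> \<alpha> ^^ i) x < crit_pt \<beta> \<alpha> then 0 else 1)"

definition tau_minus :: "real \<Rightarrow> real \<Rightarrow> real \<Rightarrow> nat \<Rightarrow> nat" where
  "tau_minus \<beta> \<alpha> x = (\<lambda>i. if (T_minus \<beta> \<alpha> ^^ i) x \<le> crit_pt \<beta> \<alpha> then 0 else 1)"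

definition Omega_plus :: "real \<Rightarrow> real \<Rightarrow> (nat \<Rightarrow> nat) set" where
  "Omega_plus \<beta> \<alpha> = tau_plus \<beta> \<alpha> ` {0..<1}"

definition Omega_minus :: "real \<Rightarrow> real \<Rightarrow> (nat \<Rightarrow> nat) set" where
  "Omega_minus \<beta> \<alpha> = tau_minus \<beta> \<alpha> ` {0<..1}"

definition Omega :: "real \<Rightarrow> real \<Rightarrow> (nat \<Rightarrow> nat) set" where
  "Omega \<beta> \<alpha> = Omega_plus \<beta> \<alpha> \<union> Omega_minus \<beta> \<alpha>"

definition periodic_word :: "(nat \<Rightarrow> nat) \<Rightarrow> bool" where
  "periodic_word \<omega> \<longleftrightarrow> (\<exists>n\<ge>1. \<forall>i. \<omega> (i + n) = \<omega> i)"

definition shift :: "(nat \<Rightarrow> nat) \<Rightarrow> nat \<Rightarrow> nat" where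
  "shift \<omega> = (\<lambda>i. \<omega> (Suc i))"

definition word_topology :: "(nat \<Rightarrow> nat) topology" where
  "word_topology = product_topology (\<lambda>_. discrete_topology {0, 1}) UNIV"

text \<open>\<^const>\<open>closedin\<close> includes that the set consists of words over \<open>{0, 1}\<close>.\<close>

definition subshift :: "(nat \<Rightarrow> nat) set \<Rightarrow> bool" where
  "subshift \<Omega> \<longleftrightarrow> closedin word_topology \<Omega> \<and> shift ` \<Omega> \<subseteq> \<Omega>"

text \<open>The set \<open>\<Omega>|\<^sup>*\<close> of finite non-empty prefixes.\<close>

definition prefix_words :: "(nat \<Rightarrow> nat) set \<Rightarrow> nat list set" where
  "prefix_words \<Omega> = {map \<omega> [0..<n] | \<omega> n. \<omega> \<in> \<Omega> \<and> n \<ge> 1}"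

text \<open>\<open>drop (length u - M) u\<close> is the suffix of \<open>u\<close> of length \<open>M\<close>.\<close>

definition subshift_of_finite_type :: "(nat \<Rightarrow> nat) set \<Rightarrow> bool" where
  "subshift_of_finite_type \<Omega> \<longleftrightarrow> subshift \<Omega> \<and>
     (\<exists>M. \<forall>u \<in> prefix_words \<Omega>. \<forall>v \<in> prefix_words \<Omega>. length u \<ge> M \<longrightarrow>
        (drop (length u - M) u @ v \<in> prefix_words \<Omega> \<longleftrightarrow> u @ v \<in> prefix_words \<Omega>))"

end

theory Submission
  imports Defs
begin

text \<open>
  The points whose expansion starts with a given word \<open>u\<close> form an interval, which \<open>T\<^bsup>|u|\<^esup>\<close> maps
  affinely onto an interval \<open>J\<^sub>u\<close>, and \<open>u v\<close> is a word of the shift iff \<open>J\<^sub>u\<close> meets the interval of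
  \<open>v\<close>. As letters are read, the left end of \<open>J\<^sub>u\<close> moves along the orbit of \<open>0 = T\<^sup>+(p)\<close> under \<open>T\<^sup>+\<close>,
  except that it is reset to \<open>0\<close> whenever \<open>p\<close> cuts the interval; the right end behaves in the same
  way with respect to \<open>1 = T\<^sup>-(p)\<close> and \<open>T\<^sup>-\<close>. If \<open>p\<close> is periodic under \<open>T\<^sup>+\<close>, the left end visits
  \<open>0\<close> within every period and forgets what was read before, so it depends only on a suffix of
  bounded length. If \<open>p\<close> is not periodic, then for a prefix \<open>u\<close> of \<open>\<tau>\<^sup>+(0)\<close> the left end of \<open>J\<^sub>u\<close> is
  strictly to the right of the left end for \<open>u\<close> without its first letter, however long \<open>u\<close> is, and
  a sufficiently long word \<open>v\<close> coding the latter point contradicts finite memory.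
  Right ends are reduced to left ends by the reflection \<open>x \<mapsto> 1 - x\<close>, which exchanges \<open>T\<^sup>-\<close> for the
  parameter \<open>\<alpha>\<close> with \<open>T\<^sup>+\<close> for \<open>2 - \<beta> - \<alpha>\<close>.
\<close>

section \<open>Binary words, complements and suffixes\<close>

definition binary_word :: "(nat \<Rightarrow> nat) \<Rightarrow> bool" where
  "binary_word \<omega> \<longleftrightarrow> (\<forall>i. \<omega> i = 0 \<or> \<omega> i = 1)"

definition flip :: "(nat \<Rightarrow> nat) \<Rightarrow> nat \<Rightarrow> nat" where
  "flip \<omega> = (\<lambda>i. if \<omega> i = 0 then 1 else 0)"

definition suffix :: "nat \<Rightarrow> (nat \<Rightarrow> nat) \<Rightarrow> nat \<Rightarrow> nat" where
  "suffix m \<omega> = (\<lambda>i. \<omega> (m + i))"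

lemma binary_wordD: "binary_word \<omega> \<Longrightarrow> \<omega> i = 0 \<or> \<omega> i = 1"
  by (simp add: binary_word_def)

lemma binary_tau_plus [simp]: "binary_word (tau_plus \<beta> \<alpha> x)"
  by (simp add: binary_word_def tau_plus_def)

lemma binary_tau_minus [simp]: "binary_word (tau_minus \<beta> \<alpha> x)"
  by (simp add: binary_word_def tau_minus_def)

lemma binary_flip [simp]: "binary_word (flip \<omega>)"
  by (simp add: binary_word_def flip_def)

lemma binary_suffix: "binary_word \<omega> \<Longrightarrow> binary_word (suffix m \<omega>)"
  by (simp add: binary_word_def suffix_def)

lemma flip_eq_iff:
  assumes "binary_word \<omega>" "binary_word \<omega>'"
  shows "flip \<omega> i = \<omega>' i \<longleftrightarrow> \<omega> i = flip \<omega>' i"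
  using assms[THEN binary_wordD, of i] by (auto simp: flip_def)

lemma flip_flip: "binary_word \<omega> \<Longrightarrow> flip (flip \<omega>) = \<omega>"
  by (simp add: flip_eq_iff fun_eq_iff)

lemma flip_eq_0_iff: "flip \<omega> i = 0 \<longleftrightarrow> \<omega> i \<noteq> 0"
  by (simp add: flip_def)

lemma flip_suffix: "flip (suffix m \<omega>) = suffix m (flip \<omega>)"
  by (simp add: flip_def suffix_def)

lemma periodic_word_flip: "periodic_word \<omega> \<Longrightarrow> periodic_word (flip \<omega>)"
  unfolding periodic_word_def flip_def by (elim exE conjE) (intro exI conjI allI, assumption, simp)

lemma tau_plus_shift: "tau_plus \<beta> \<alpha> ((T_plus \<beta> \<alpha> ^^ n) x) i = tau_plus \<beta> \<alpha> x (n + i)"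
  by (simp add: tau_plus_def funpow_add add.commute[of n i])

section \<open>The two affine branches and the critical point\<close>

locale intermediate_beta =
  fixes \<beta> \<alpha> :: real
  assumes beta_gt_1: "1 < \<beta>" and alpha_pos: "0 < \<alpha>" and alpha_less: "\<alpha> < 2 - \<beta>"
begin

abbreviation p :: real where "p \<equiv> crit_pt \<beta> \<alpha>"

lemma beta_p: "\<beta> * p = 1 - \<alpha>"
  using beta_gt_1 by (simp add: crit_pt_def)

lemma p_pos: "0 < p" and p_less_1: "p < 1"
  using beta_gt_1 alpha_pos alpha_less by (simp_all add: crit_pt_def field_simps)

text \<open>Each branch is extended affinely to the whole line, so that branches can be composed
  along any word, realised or not.\<close>

definition branch :: "nat \<Rightarrow> real \<Rightarrow> real" where
  "branch b x = \<beta> * x + \<alpha> - (if b = 0 then 0 else 1)"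

lemma branch_le_iff [simp]: "branch b x \<le> branch b y \<longleftrightarrow> x \<le> y"
  and branch_less_iff [simp]: "branch b x < branch b y \<longleftrightarrow> x < y"
  and branch_eq_iff [simp]: "branch b x = branch b y \<longleftrightarrow> x = y"
  using beta_gt_1 by (simp_all add: branch_def)

lemma branch_pos_p: "b \<noteq> 0 \<Longrightarrow> branch b p = 0"
  by (simp add: branch_def beta_p)

lemma T_plus_branch: "T_plus \<beta> \<alpha> x = branch (if x < p then 0 else 1) x"
  by (simp add: T_plus_def branch_def)

lemma T_plus_range: "0 \<le> x \<Longrightarrow> x < 1 \<Longrightarrow> 0 \<le> T_plus \<beta> \<alpha> x \<and> T_plus \<beta> \<alpha> x < 1"
proof -
  assume x: "0 \<le> x" "x < 1"
  have "\<beta> * x < \<beta>" "0 \<le> \<beta> * x" using x beta_gt_1 by simp_all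
  moreover have "x < p \<Longrightarrow> \<beta> * x < \<beta> * p" "p \<le> x \<Longrightarrow> \<beta> * p \<le> \<beta> * x"
    using beta_gt_1 by simp_all
  ultimately show ?thesis
    using alpha_less alpha_pos by (auto simp: T_plus_def beta_p not_less)
qed

lemma T_plus_funpow_range:
  "0 \<le> x \<Longrightarrow> x < 1 \<Longrightarrow> 0 \<le> (T_plus \<beta> \<alpha> ^^ n) x \<and> (T_plus \<beta> \<alpha> ^^ n) x < 1"
  by (induction n) (auto simp: T_plus_range)

section \<open>Affine maps along a word and the ends of the image interval\<close>

primrec follow :: "(nat \<Rightarrow> nat) \<Rightarrow> nat \<Rightarrow> real \<Rightarrow> real" where
  "follow \<omega> 0 x = x"
| "follow \<omega> (Suc n) x = branch (\<omega> n) (follow \<omega> n x)"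

text \<open>The open interval between \<open>lower \<omega> n\<close> and \<open>upper \<omega> n\<close> is \<open>J\<^sub>u\<close> for the prefix \<open>u\<close> of length
  \<open>n\<close> of \<open>\<omega>\<close>. Once it is empty, the values have no meaning, but they stay in the wrong order.\<close>

primrec lower :: "(nat \<Rightarrow> nat) \<Rightarrow> nat \<Rightarrow> real" where
  "lower \<omega> 0 = 0"
| "lower \<omega> (Suc n) = branch (\<omega> n) (if \<omega> n = 0 then lower \<omega> n else max p (lower \<omega> n))"

primrec upper :: "(nat \<Rightarrow> nat) \<Rightarrow> nat \<Rightarrow> real" where
  "upper \<omega> 0 = 1"
| "upper \<omega> (Suc n) = branch (\<omega> n) (if \<omega> n = 0 then min p (upper \<omega> n) else upper \<omega> n)"

definition admissible :: "(nat \<Rightarrow> nat) \<Rightarrow> nat \<Rightarrow> bool" where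
  "admissible \<omega> n \<longleftrightarrow> lower \<omega> n < upper \<omega> n"

lemma lower_nonneg: "0 \<le> lower \<omega> n"
proof (induction n)
  case (Suc n)
  show ?case
  proof (cases "\<omega> n = 0")
    case True
    then show ?thesis using Suc beta_gt_1 alpha_pos by (simp add: branch_def)
  next
    case False
    have "branch (\<omega> n) p \<le> branch (\<omega> n) (max p (lower \<omega> n))" by simp
    with False show ?thesis by (simp add: branch_pos_p)
  qed
qed simp

lemma lower_cong: "(\<And>i. i < n \<Longrightarrow> \<omega> i = \<omega>' i) \<Longrightarrow> lower \<omega> n = lower \<omega>' n"
  by (induction n) simp_all

lemma upper_cong: "(\<And>i. i < n \<Longrightarrow> \<omega> i = \<omega>' i) \<Longrightarrow> upper \<omega> n = upper \<omega>' n"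
  by (induction n) simp_all

lemma admissible_cong: "(\<And>i. i < n \<Longrightarrow> \<omega> i = \<omega>' i) \<Longrightarrow> admissible \<omega> n = admissible \<omega>' n"
  unfolding admissible_def using lower_cong[of n \<omega> \<omega>'] upper_cong[of n \<omega> \<omega>'] by simp

lemma admissible_SucD: "admissible \<omega> (Suc n) \<Longrightarrow> admissible \<omega> n"
  by (auto simp: admissible_def split: if_splits)

text \<open>The suffix starts from \<open>0\<close>, the least value a left end can have, and each
  step of the recursion is monotone in the end.\<close>

lemma lower_suffix_le: "lower (suffix m \<omega>) n \<le> lower \<omega> (m + n)"
  by (induction n) (auto simp: lower_nonneg suffix_def le_max_iff_disj)

text \<open>The next left end depends only on the current one and the letter read, so ends that have
  met stay together.\<close>

lemma lower_suffix_eq: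
  "lower (suffix m \<omega>) n = lower \<omega> (m + n) \<Longrightarrow> n \<le> k \<Longrightarrow> lower (suffix m \<omega>) k = lower \<omega> (m + k)"
proof (induction k)
  case (Suc k)
  then show ?case by (cases "n = Suc k") (auto simp: suffix_def)
qed simp

lemma follow_diff: "follow \<omega> n x - follow \<omega> n y = \<beta> ^ n * (x - y)"
proof (induction n)
  case (Suc n)
  have "follow \<omega> (Suc n) x - follow \<omega> (Suc n) y = \<beta> * (follow \<omega> n x - follow \<omega> n y)"
    by (simp add: branch_def algebra_simps)
  with Suc show ?case by simp
qed simp

lemma follow_surj: "\<exists>x. follow \<omega> n x = y"
proof
  show "follow \<omega> n ((y - follow \<omega> n 0) / \<beta> ^ n) = y"
    using follow_diff[of \<omega> n "(y - follow \<omega> n 0) / \<beta> ^ n" 0] beta_gt_1 by simp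
qed

lemma follow_le_iff [simp]: "follow \<omega> n x \<le> follow \<omega> n y \<longleftrightarrow> x \<le> y"
  by (induction n) simp_all

lemma follow_less_iff [simp]: "follow \<omega> n x < follow \<omega> n y \<longleftrightarrow> x < y"
  by (simp add: less_le_not_le)

lemma follow_tau_plus:
  "(\<And>i. i < n \<Longrightarrow> tau_plus \<beta> \<alpha> x i = \<omega> i) \<Longrightarrow> follow \<omega> n x = (T_plus \<beta> \<alpha> ^^ n) x"
proof (induction n)
  case (Suc n)
  have "tau_plus \<beta> \<alpha> x n = \<omega> n" using Suc.prems by simp
  moreover have "(T_plus \<beta> \<alpha> ^^ Suc n) x = branch (tau_plus \<beta> \<alpha> x n) ((T_plus \<beta> \<alpha> ^^ n) x)"
    by (simp add: tau_plus_def T_plus_branch[of "(T_plus \<beta> \<alpha> ^^ n) x"])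
  ultimately show ?case using Suc by simp
qed simp

text \<open>Each further letter restricts the image of \<open>x\<close> to one side of
  \<open>p\<close>, and the branches are increasing, so the conditions on \<open>x\<close>
  accumulate to two bounds on its image. The left bound is closed and the right one open because
  \<open>tau_plus\<close> gives the point \<open>p\<close> the letter 1.\<close>

lemma tau_plus_prefix_iff:
  assumes "binary_word \<omega>"
  shows "0 \<le> x \<and> x < 1 \<and> (\<forall>i<n. tau_plus \<beta> \<alpha> x i = \<omega> i) \<longleftrightarrow>
    lower \<omega> n \<le> follow \<omega> n x \<and> follow \<omega> n x < upper \<omega> n"
proof (induction n)
  case (Suc n)
  define agree where "agree m \<longleftrightarrow> (\<forall>i<m. tau_plus \<beta> \<alpha> x i = \<omega> i)" for m
  have split: "agree (Suc n) \<longleftrightarrow> agree n \<and> tau_plus \<beta> \<alpha> x n = \<omega> n"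
    by (auto simp: agree_def less_Suc_eq)
  have digit: "tau_plus \<beta> \<alpha> x n = \<omega> n \<longleftrightarrow> (if \<omega> n = 0 then follow \<omega> n x < p else p \<le> follow \<omega> n x)"
    if "agree n"
    using that follow_tau_plus[of n x \<omega>] binary_wordD[OF assms, of n]
    by (auto simp: tau_plus_def agree_def)
  have "0 \<le> x \<and> x < 1 \<and> agree n \<longleftrightarrow> lower \<omega> n \<le> follow \<omega> n x \<and> follow \<omega> n x < upper \<omega> n"
    using Suc unfolding agree_def .
  then have "0 \<le> x \<and> x < 1 \<and> agree (Suc n) \<longleftrightarrow>
      lower \<omega> (Suc n) \<le> follow \<omega> (Suc n) x \<and> follow \<omega> (Suc n) x < upper \<omega> (Suc n)"
    using digit unfolding split by auto
  then show ?case unfolding agree_def .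
qed auto

section \<open>The reflection \<open>x \<mapsto> 1 - x\<close>\<close>

lemma reflected: "intermediate_beta \<beta> (2 - \<beta> - \<alpha>)"
  using beta_gt_1 alpha_pos alpha_less by unfold_locales auto

lemma crit_pt_reflected: "crit_pt \<beta> (2 - \<beta> - \<alpha>) = 1 - p"
  using beta_gt_1 by (simp add: crit_pt_def field_simps)

lemma T_minus_reflected:
  "(T_minus \<beta> \<alpha> ^^ n) x = 1 - (T_plus \<beta> (2 - \<beta> - \<alpha>) ^^ n) (1 - x)"
proof (induction n)
  case (Suc n)
  have "T_minus \<beta> \<alpha> y = 1 - T_plus \<beta> (2 - \<beta> - \<alpha>) (1 - y)" for y
    unfolding T_minus_def T_plus_def crit_pt_reflected by (simp add: algebra_simps)
  with Suc show ?case by simp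
qed simp

lemma tau_minus_reflected: "tau_minus \<beta> \<alpha> x = flip (tau_plus \<beta> (2 - \<beta> - \<alpha>) (1 - x))"
  by (auto simp: tau_minus_def tau_plus_def flip_def T_minus_reflected crit_pt_reflected fun_eq_iff)

lemma branch_reflected:
  "intermediate_beta.branch \<beta> (2 - \<beta> - \<alpha>) (flip \<omega> n) (1 - x) = 1 - branch (\<omega> n) x"
  unfolding intermediate_beta.branch_def[OF reflected] branch_def flip_def
  by (simp add: algebra_simps)

lemma follow_reflected:
  "intermediate_beta.follow \<beta> (2 - \<beta> - \<alpha>) (flip \<omega>) n (1 - x) = 1 - follow \<omega> n x"
  by (induction n)
    (simp_all add: intermediate_beta.follow.simps[OF reflected] branch_reflected)

lemma lower_reflected:
  "intermediate_beta.lower \<beta> (2 - \<beta> - \<alpha>) (flip \<omega>) n = 1 - upper \<omega> n"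
proof (induction n)
  case (Suc n)
  have "max (1 - p) (1 - upper \<omega> n) = 1 - min p (upper \<omega> n)" by simp
  then show ?case
    using Suc
    by (simp add: intermediate_beta.lower.simps[OF reflected] crit_pt_reflected flip_eq_0_iff
        flip: branch_reflected)
qed (simp add: intermediate_beta.lower.simps[OF reflected])

lemma upper_reflected:
  "intermediate_beta.upper \<beta> (2 - \<beta> - \<alpha>) (flip \<omega>) n = 1 - lower \<omega> n"
proof (induction n)
  case (Suc n)
  have "min (1 - p) (1 - lower \<omega> n) = 1 - max p (lower \<omega> n)" by simp
  then show ?case
    using Suc
    by (simp add: intermediate_beta.upper.simps[OF reflected] crit_pt_reflected flip_eq_0_iff
        flip: branch_reflected)
qed (simp add: intermediate_beta.upper.simps[OF reflected])

lemma admissible_reflected: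
  "intermediate_beta.admissible \<beta> (2 - \<beta> - \<alpha>) (flip \<omega>) n \<longleftrightarrow> admissible \<omega> n"
  by (simp add: intermediate_beta.admissible_def[OF reflected] admissible_def
      lower_reflected upper_reflected)

lemma upper_le_1: "upper \<omega> n \<le> 1"
  using intermediate_beta.lower_nonneg[OF reflected, of "flip \<omega>" n] by (simp add: lower_reflected)

lemma upper_suffix_ge: "upper \<omega> (m + n) \<le> upper (suffix m \<omega>) n"
  by (induction n) (auto simp: upper_le_1 suffix_def min_le_iff_disj)

lemma admissible_suffix: "admissible \<omega> (m + n) \<Longrightarrow> admissible (suffix m \<omega>) n"
  using lower_suffix_le[of m \<omega> n] upper_suffix_ge[of \<omega> m n] by (simp add: admissible_def)

text \<open>The reflection swaps the closed and the open end, in accordance with the letter 0 that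
  \<open>tau_minus\<close> gives to \<open>p\<close>.\<close>

lemma tau_minus_prefix_iff:
  assumes "binary_word \<omega>"
  shows "0 < x \<and> x \<le> 1 \<and> (\<forall>i<n. tau_minus \<beta> \<alpha> x i = \<omega> i) \<longleftrightarrow>
    lower \<omega> n < follow \<omega> n x \<and> follow \<omega> n x \<le> upper \<omega> n"
  using intermediate_beta.tau_plus_prefix_iff[OF reflected, of "flip \<omega>" "1 - x" n] assms
  by (auto simp: follow_reflected lower_reflected upper_reflected tau_minus_reflected flip_eq_iff)

section \<open>Expansion and the language of the shift\<close>

text \<open>While the digits agree, both points follow the same branches, so their distance grows by
  the factor \<beta> in each step, yet both images stay in \<open>[0, 1)\<close>.\<close>

lemma tau_plus_agree_dist:
  assumes x: "0 \<le> x" "x < 1" and y: "0 \<le> y" "y < 1"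
    and eq: "\<And>i. i < n \<Longrightarrow> tau_plus \<beta> \<alpha> x i = tau_plus \<beta> \<alpha> y i"
  shows "\<beta> ^ n * \<bar>x - y\<bar> < 1"
proof -
  define \<omega> where "\<omega> = tau_plus \<beta> \<alpha> x"
  have "follow \<omega> n x = (T_plus \<beta> \<alpha> ^^ n) x" "follow \<omega> n y = (T_plus \<beta> \<alpha> ^^ n) y"
    by (rule follow_tau_plus; simp add: \<omega>_def eq)+
  then have "\<bar>\<beta> ^ n * (x - y)\<bar> < 1"
    using T_plus_funpow_range[OF x, of n] T_plus_funpow_range[OF y, of n]
    unfolding follow_diff[of \<omega>, symmetric] by (simp only: abs_less_iff) linarith
  then show ?thesis using beta_gt_1 by (simp add: abs_mult)
qed

lemma beta_power_large:
  assumes "0 < e" obtains n where "1 < \<beta> ^ n * e"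
  using real_arch_pow[OF beta_gt_1, of "1 / e"] assms by (auto simp: field_simps)

lemma tau_plus_inj:
  assumes "0 \<le> x" "x < 1" "0 \<le> y" "y < 1" "tau_plus \<beta> \<alpha> x = tau_plus \<beta> \<alpha> y"
  shows "x = y"
proof (rule ccontr)
  assume "x \<noteq> y"
  then obtain n where "1 < \<beta> ^ n * \<bar>x - y\<bar>" using beta_power_large[of "\<bar>x - y\<bar>"] by auto
  with tau_plus_agree_dist[of x y n] assms show False by simp
qed

lemma tau_plus_admissible:
  assumes "0 \<le> x" "x < 1" shows "admissible (tau_plus \<beta> \<alpha> x) n"
  using tau_plus_prefix_iff[of "tau_plus \<beta> \<alpha> x" x n] assms by (force simp: admissible_def)

lemma tau_minus_admissible:
  assumes "0 < x" "x \<le> 1" shows "admissible (tau_minus \<beta> \<alpha> x) n"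
  using tau_minus_prefix_iff[of "tau_minus \<beta> \<alpha> x" x n] assms by (force simp: admissible_def)

text \<open>Membership becomes a condition on finite prefixes: admissible prefixes give nested
  intervals of points, and a point common to their closures is coded by the word through
  \<open>tau_plus\<close> or \<open>tau_minus\<close>.\<close>

lemma Omega_eq: "Omega \<beta> \<alpha> = {\<omega>. binary_word \<omega> \<and> (\<forall>n. admissible \<omega> n)}"
proof (intro equalityI subsetI)
  fix \<omega> assume "\<omega> \<in> Omega \<beta> \<alpha>"
  then show "\<omega> \<in> {\<omega>. binary_word \<omega> \<and> (\<forall>n. admissible \<omega> n)}"
    by (auto simp: Omega_def Omega_plus_def Omega_minus_def tau_plus_admissible tau_minus_admissible)
next
  fix \<omega> assume "\<omega> \<in> {\<omega>. binary_word \<omega> \<and> (\<forall>n. admissible \<omega> n)}"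
  then have bin: "binary_word \<omega>" and adm: "lower \<omega> n < upper \<omega> n" for n by (auto simp: admissible_def)
  have "\<forall>n. \<exists>x. follow \<omega> n x = lower \<omega> n" "\<forall>n. \<exists>x. follow \<omega> n x = upper \<omega> n"
    using follow_surj by simp_all
  \<comment> \<open>The ends of the image interval are pulled back to \<open>c n\<close> and
    \<open>d n\<close>, the ends of the interval of points whose expansion starts with the first
    \<open>n\<close> letters.\<close>
  then obtain c d where c: "\<And>n. follow \<omega> n (c n) = lower \<omega> n"
    and d: "\<And>n. follow \<omega> n (d n) = upper \<omega> n"
    unfolding choice_iff by blast
  have "follow \<omega> (Suc n) (c n) \<le> follow \<omega> (Suc n) (c (Suc n))" for n
    unfolding c using c[of n] by simp
  then have inc: "incseq c" by (intro incseq_SucI) (simp only: follow_le_iff)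
  have "follow \<omega> (Suc n) (d (Suc n)) \<le> follow \<omega> (Suc n) (d n)" for n
    unfolding d using d[of n] by simp
  then have dec: "decseq d" by (intro decseq_SucI) (simp only: follow_le_iff)
  have cd: "c n < d n" for n using adm[of n] unfolding c[symmetric] d[symmetric] by simp
  have cd': "c n \<le> d m" for n m
    using incseqD[OF inc, of n "max n m"] decseqD[OF dec, of m "max n m"] cd[of "max n m"] by simp
  define x where "x = (SUP n. c n)"
  have bdd: "bdd_above (range c)" using cd' by (meson bdd_above.I2)
  have cx: "c n \<le> x" for n unfolding x_def using bdd by (rule cSUP_upper2[of _ _ n]) auto
  have xd: "x \<le> d n" for n unfolding x_def using cd' by (intro cSUP_least) auto
  \<comment> \<open>\<open>\<tau>\<^sup>+(x)\<close> can fail to be \<open>\<omega>\<close> only if some \<open>d n\<close> equals \<open>x\<close>; then no \<open>c n\<close> does, and \<open>\<tau>\<^sup>-(x) = \<omega>\<close>.\<close>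
  show "\<omega> \<in> Omega \<beta> \<alpha>"
  proof (cases "\<forall>n. x < d n")
    case True
    then have "lower \<omega> n \<le> follow \<omega> n x \<and> follow \<omega> n x < upper \<omega> n" for n
      using cx unfolding c[symmetric] d[symmetric] by simp
    then have "0 \<le> x \<and> x < 1 \<and> (\<forall>i<n. tau_plus \<beta> \<alpha> x i = \<omega> i)" for n
      using tau_plus_prefix_iff[OF bin] by blast
    then have "x \<in> {0..<1}" "tau_plus \<beta> \<alpha> x = \<omega>" by auto
    then show ?thesis by (auto simp: Omega_def Omega_plus_def)
  next
    case False
    then obtain m where m: "d m \<le> x" by (auto simp: not_less)
    have "c n < x" for n
      using incseqD[OF inc, of n "max n m"] decseqD[OF dec, of m "max n m"] cd[of "max n m"] m
      by simp
    then have "lower \<omega> n < follow \<omega> n x \<and> follow \<omega> n x \<le> upper \<omega> n" for n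
      using xd unfolding c[symmetric] d[symmetric] by simp
    then have "0 < x \<and> x \<le> 1 \<and> (\<forall>i<n. tau_minus \<beta> \<alpha> x i = \<omega> i)" for n
      using tau_minus_prefix_iff[OF bin] by blast
    then have "x \<in> {0<..1}" "tau_minus \<beta> \<alpha> x = \<omega>" by auto
    then show ?thesis by (auto simp: Omega_def Omega_minus_def)
  qed
qed

text \<open>The closed left end supplies a witness, so \<open>tau_plus\<close> alone already
  realises every admissible prefix.\<close>

lemma admissible_iff_tau_plus:
  assumes "binary_word \<omega>"
  shows "admissible \<omega> n \<longleftrightarrow> (\<exists>x. 0 \<le> x \<and> x < 1 \<and> (\<forall>i<n. tau_plus \<beta> \<alpha> x i = \<omega> i))"
proof
  assume adm: "admissible \<omega> n"
  obtain x where "follow \<omega> n x = lower \<omega> n" using follow_surj by blast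
  then show "\<exists>x. 0 \<le> x \<and> x < 1 \<and> (\<forall>i<n. tau_plus \<beta> \<alpha> x i = \<omega> i)"
    using adm tau_plus_prefix_iff[OF assms, of x n] by (auto simp: admissible_def)
next
  assume "\<exists>x. 0 \<le> x \<and> x < 1 \<and> (\<forall>i<n. tau_plus \<beta> \<alpha> x i = \<omega> i)"
  then show "admissible \<omega> n"
    unfolding tau_plus_prefix_iff[OF assms] admissible_def by force
qed

lemma map_in_prefix_words_iff:
  assumes bin: "binary_word \<omega>" and "n \<ge> 1"
  shows "map \<omega> [0..<n] \<in> prefix_words (Omega \<beta> \<alpha>) \<longleftrightarrow> admissible \<omega> n"
proof
  assume "map \<omega> [0..<n] \<in> prefix_words (Omega \<beta> \<alpha>)"
  then obtain \<omega>' k where \<omega>': "\<omega>' \<in> Omega \<beta> \<alpha>" and eq: "map \<omega> [0..<n] = map \<omega>' [0..<k]"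
    by (auto simp: prefix_words_def)
  have "k = n" using arg_cong[OF eq, of length] by simp
  with eq have "\<omega> i = \<omega>' i" if "i < n" for i using that by simp
  then have "admissible \<omega> n = admissible \<omega>' n" by (rule admissible_cong)
  with \<omega>' show "admissible \<omega> n" by (simp add: Omega_eq)
next
  assume "admissible \<omega> n"
  then obtain x where x: "0 \<le> x" "x < 1" and eq: "\<forall>i<n. tau_plus \<beta> \<alpha> x i = \<omega> i"
    using admissible_iff_tau_plus[OF bin] by blast
  have "tau_plus \<beta> \<alpha> x \<in> Omega \<beta> \<alpha>"
    using x by (auto simp: Omega_def Omega_plus_def)
  moreover have "map \<omega> [0..<n] = map (tau_plus \<beta> \<alpha> x) [0..<n]" using eq by simp
  ultimately show "map \<omega> [0..<n] \<in> prefix_words (Omega \<beta> \<alpha>)"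
    using \<open>n \<ge> 1\<close> unfolding prefix_words_def by blast
qed

section \<open>The shift as a closed invariant set, and finite type as finite memory\<close>

lemma subshift_Omega: "subshift (Omega \<beta> \<alpha>)"
proof -
  have top: "topspace word_topology = {\<omega>. binary_word \<omega>}"
    by (simp add: set_eq_iff PiE_iff word_topology_def binary_word_def)
  have "openin word_topology (topspace word_topology - Omega \<beta> \<alpha>)"
  proof (subst openin_subopen, intro ballI)
    fix \<omega> assume "\<omega> \<in> topspace word_topology - Omega \<beta> \<alpha>"
    then obtain n where bin: "binary_word \<omega>" and n: "\<not> admissible \<omega> n"
      by (auto simp: top Omega_eq)
    \<comment> \<open>Inadmissibility is decided by the first \<open>n\<close> letters, so the whole
      cylinder of length \<open>n\<close> around \<omega> avoids the shift.\<close>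
    let ?X = "\<lambda>i. if i < n then {\<omega> i} else {0, 1 :: nat}"
    let ?C = "\<Pi>\<^sub>E i\<in>UNIV. ?X i"
    have "openin word_topology ?C"
      unfolding word_topology_def
    proof (rule product_topology_basis)
      show "openin (discrete_topology {0, 1}) (?X i)" for i
        using binary_wordD[OF bin, of i] by auto
      show "finite {i. ?X i \<noteq> topspace (discrete_topology {0, 1})}"
        by (rule finite_subset[of _ "{..<n}"]) auto
    qed
    moreover have "\<omega> \<in> ?C" using binary_wordD[OF bin] by auto
    moreover have "?C \<subseteq> topspace word_topology - Omega \<beta> \<alpha>"
    proof
      fix \<omega>' assume \<omega>': "\<omega>' \<in> ?C"
      then have X: "\<omega>' i \<in> ?X i" for i by (simp add: PiE_iff)
      then have eq: "\<omega>' i = \<omega> i" if "i < n" for i using that by (metis singletonD)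
      have "binary_word \<omega>'"
        unfolding binary_word_def
      proof
        show "\<omega>' i = 0 \<or> \<omega>' i = 1" for i
          using X[of i] binary_wordD[OF bin, of i] by (auto split: if_splits)
      qed
      moreover have "\<not> admissible \<omega>' n"
        using n admissible_cong[of n \<omega>' \<omega>] eq by simp
      ultimately show "\<omega>' \<in> topspace word_topology - Omega \<beta> \<alpha>"
        by (auto simp: top Omega_eq)
    qed
    ultimately show "\<exists>T. openin word_topology T \<and> \<omega> \<in> T \<and>
        T \<subseteq> topspace word_topology - Omega \<beta> \<alpha>" by blast
  qed
  then have "closedin word_topology (Omega \<beta> \<alpha>)"
    by (auto simp: closedin_def top Omega_eq)
  moreover have "shift ` Omega \<beta> \<alpha> \<subseteq> Omega \<beta> \<alpha>"
  proof -
    have "shift \<omega> = suffix 1 \<omega>" for \<omega> by (simp add: shift_def suffix_def)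
    then show ?thesis
      by (auto simp: Omega_eq binary_suffix intro!: admissible_suffix)
  qed
  ultimately show ?thesis by (simp add: subshift_def)
qed

text \<open>With \<open>u\<close>, \<open>w\<close> and \<open>v\<close> the blocks of lengths \<open>m\<close>, \<open>M\<close> and \<open>n\<close> of \<open>\<omega>\<close>: if \<open>u w\<close>, \<open>v\<close> and \<open>w v\<close> are
  admissible, then so is \<open>u w v\<close>. The other half of the finite type condition always holds.\<close>

definition has_memory :: "nat \<Rightarrow> bool" where
  "has_memory M \<longleftrightarrow> (\<forall>\<omega> m n. binary_word \<omega> \<longrightarrow> admissible \<omega> (m + M) \<longrightarrow>
     admissible (suffix (m + M) \<omega>) n \<longrightarrow>
     admissible (suffix m \<omega>) (M + n) \<longrightarrow> admissible \<omega> (m + (M + n)))"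

lemma map_upt_append:
  "map \<omega> [0..<m + n] = map \<omega> [0..<m] @ map (suffix m \<omega>) [0..<n]"
  by (induction n) (simp_all add: suffix_def)

lemma subshift_of_finite_type_iff:
  "subshift_of_finite_type (Omega \<beta> \<alpha>) \<longleftrightarrow> (\<exists>M. has_memory M)"
proof
  assume "subshift_of_finite_type (Omega \<beta> \<alpha>)"
  then obtain M where M: "\<And>u v. u \<in> prefix_words (Omega \<beta> \<alpha>) \<Longrightarrow> v \<in> prefix_words (Omega \<beta> \<alpha>) \<Longrightarrow>
      M \<le> length u \<Longrightarrow> drop (length u - M) u @ v \<in> prefix_words (Omega \<beta> \<alpha>) \<longleftrightarrow>
      u @ v \<in> prefix_words (Omega \<beta> \<alpha>)"
    unfolding subshift_of_finite_type_def by blast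
  have "has_memory M"
    unfolding has_memory_def
  proof (intro allI impI)
    fix \<omega> m n
    assume bin: "binary_word \<omega>" and u: "admissible \<omega> (m + M)"
      and v: "admissible (suffix (m + M) \<omega>) n" and wv: "admissible (suffix m \<omega>) (M + n)"
    let ?u = "map \<omega> [0..<m + M]" and ?v = "map (suffix (m + M) \<omega>) [0..<n]"
    show "admissible \<omega> (m + (M + n))"
    \<comment> \<open>\<open>prefix_words\<close> contains only non-empty words;
      \<open>m > 0\<close> and \<open>n > 0\<close> ensure this for both blocks, even if
      \<open>M = 0\<close>.\<close>
    proof (cases "m = 0 \<or> n = 0")
      case True
      then show ?thesis using u wv by (auto simp: suffix_def)
    next
      case False
      have uv: "map \<omega> [0..<m + (M + n)] = ?u @ ?v"
        using map_upt_append[of \<omega> "m + M" n] by (simp add: add.assoc)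
      have "drop m ?u = map (suffix m \<omega>) [0..<M]"
        using map_upt_append[of \<omega> m M] by simp
      then have "map (suffix m \<omega>) [0..<M + n] = drop m ?u @ ?v"
        using map_upt_append[of "suffix m \<omega>" M n] by (simp add: suffix_def add.assoc)
      then have "drop (length ?u - M) ?u @ ?v \<in> prefix_words (Omega \<beta> \<alpha>)"
        using map_in_prefix_words_iff[of "suffix m \<omega>" "M + n"] False wv bin
        by (simp add: binary_suffix)
      moreover have "?u \<in> prefix_words (Omega \<beta> \<alpha>)" "?v \<in> prefix_words (Omega \<beta> \<alpha>)"
        using False bin u v by (simp_all add: map_in_prefix_words_iff binary_suffix)
      ultimately have "?u @ ?v \<in> prefix_words (Omega \<beta> \<alpha>)"
        using M[of ?u ?v] by simp
      then show ?thesis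
        unfolding uv[symmetric] using map_in_prefix_words_iff[OF bin, of "m + (M + n)"] False by simp
    qed
  qed
  then show "\<exists>M. has_memory M" ..
next
  assume "\<exists>M. has_memory M"
  then obtain M where M: "has_memory M" ..
  have "drop (length u - M) u @ v \<in> prefix_words (Omega \<beta> \<alpha>) \<longleftrightarrow> u @ v \<in> prefix_words (Omega \<beta> \<alpha>)"
    if uv: "u \<in> prefix_words (Omega \<beta> \<alpha>)" "v \<in> prefix_words (Omega \<beta> \<alpha>)" and len: "M \<le> length u" for u v
  proof -
    obtain \<omega>\<^sub>1 k where 1: "\<omega>\<^sub>1 \<in> Omega \<beta> \<alpha>" "u = map \<omega>\<^sub>1 [0..<k]" "k \<ge> 1"
      using uv(1) unfolding prefix_words_def by blast
    obtain \<omega>\<^sub>2 n where 2: "\<omega>\<^sub>2 \<in> Omega \<beta> \<alpha>" "v = map \<omega>\<^sub>2 [0..<n]" "n \<ge> 1"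
      using uv(2) unfolding prefix_words_def by blast
    \<comment> \<open>Gluing at position \<open>k\<close> makes \<open>u\<close>, \<open>v\<close>
      and their concatenations blocks of one infinite word, as \<open>has_memory\<close>
      requires.\<close>
    define \<omega> where "\<omega> = (\<lambda>i. if i < k then \<omega>\<^sub>1 i else \<omega>\<^sub>2 (i - k))"
    define m where "m = k - M"
    have k: "k = m + M" using len 1(2) by (simp add: m_def)
    have bin: "binary_word \<omega>" using 1(1) 2(1) by (auto simp: Omega_eq binary_word_def \<omega>_def)
    have suf: "suffix k \<omega> = \<omega>\<^sub>2" by (simp add: suffix_def \<omega>_def)
    have u: "u = map \<omega> [0..<k]" unfolding 1(2) by (simp add: \<omega>_def)
    have whole: "u @ v = map \<omega> [0..<m + (M + n)]"
      using map_upt_append[of \<omega> k n] suf u 2(2) k by (simp add: add.assoc)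
    then have "drop m (u @ v) = map (suffix m \<omega>) [0..<M + n]"
      using map_upt_append[of \<omega> m "M + n"] by simp
    moreover have "drop m (u @ v) = drop (length u - M) u @ v"
      using u k by simp
    ultimately have part: "drop (length u - M) u @ v = map (suffix m \<omega>) [0..<M + n]" by simp
    have "admissible \<omega> k"
      using admissible_cong[of k \<omega> \<omega>\<^sub>1] 1(1) by (simp add: Omega_eq \<omega>_def)
    moreover have "admissible (suffix k \<omega>) n"
      using 2(1) by (simp add: suf Omega_eq)
    ultimately have "admissible (suffix m \<omega>) (M + n) \<longleftrightarrow> admissible \<omega> (m + (M + n))"
      using M bin admissible_suffix[of \<omega> m "M + n"] unfolding has_memory_def k by blast
    then show ?thesis
      unfolding part unfolding whole using bin \<open>n \<ge> 1\<close>
      by (simp add: map_in_prefix_words_iff binary_suffix)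
  qed
  then show "subshift_of_finite_type (Omega \<beta> \<alpha>)"
    using subshift_Omega unfolding subshift_of_finite_type_def by blast
qed

text \<open>Complementing letters is an involution on binary words that matches admissibility for
  the two parameters. It transfers the necessity of periodicity from \<open>tau_plus\<close> to
  \<open>tau_minus\<close>.\<close>

lemma has_memory_reflected:
  "intermediate_beta.has_memory \<beta> (2 - \<beta> - \<alpha>) M \<longleftrightarrow> has_memory M"
proof -
  have eq: "intermediate_beta.admissible \<beta> (2 - \<beta> - \<alpha>) \<omega> n \<longleftrightarrow> admissible (flip \<omega>) n"
    if "binary_word \<omega>" for \<omega> n
    using admissible_reflected[of "flip \<omega>" n] flip_flip[OF that] by simp
  show ?thesis
    unfolding intermediate_beta.has_memory_def[OF reflected]
  proof
    assume H: "\<forall>\<omega> m n. binary_word \<omega> \<longrightarrow>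
       intermediate_beta.admissible \<beta> (2 - \<beta> - \<alpha>) \<omega> (m + M) \<longrightarrow>
       intermediate_beta.admissible \<beta> (2 - \<beta> - \<alpha>) (suffix (m + M) \<omega>) n \<longrightarrow>
       intermediate_beta.admissible \<beta> (2 - \<beta> - \<alpha>) (suffix m \<omega>) (M + n) \<longrightarrow>
       intermediate_beta.admissible \<beta> (2 - \<beta> - \<alpha>) \<omega> (m + (M + n))"
    show "has_memory M"
      unfolding has_memory_def
    proof (intro allI)
      fix \<omega> m n
      show "binary_word \<omega> \<longrightarrow> admissible \<omega> (m + M) \<longrightarrow> admissible (suffix (m + M) \<omega>) n \<longrightarrow>
          admissible (suffix m \<omega>) (M + n) \<longrightarrow> admissible \<omega> (m + (M + n))"
        using H[rule_format, of "flip \<omega>" m n]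
        by (simp add: admissible_reflected flip: flip_suffix)
    qed
  next
    assume M: "has_memory M"
    show "\<forall>\<omega> m n. binary_word \<omega> \<longrightarrow>
       intermediate_beta.admissible \<beta> (2 - \<beta> - \<alpha>) \<omega> (m + M) \<longrightarrow>
       intermediate_beta.admissible \<beta> (2 - \<beta> - \<alpha>) (suffix (m + M) \<omega>) n \<longrightarrow>
       intermediate_beta.admissible \<beta> (2 - \<beta> - \<alpha>) (suffix m \<omega>) (M + n) \<longrightarrow>
       intermediate_beta.admissible \<beta> (2 - \<beta> - \<alpha>) \<omega> (m + (M + n))"
      using M[unfolded has_memory_def, rule_format, OF binary_flip]
      by (simp add: eq binary_suffix flip_suffix)
  qed
qed

section \<open>Periodic critical orbits give finite memory\<close>

lemma tau_plus_reflected: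
  "tau_plus \<beta> (2 - \<beta> - \<alpha>) (crit_pt \<beta> (2 - \<beta> - \<alpha>)) = flip (tau_minus \<beta> \<alpha> p)"
  by (simp add: tau_minus_reflected crit_pt_reflected flip_flip)

lemma T_plus_p: "T_plus \<beta> \<alpha> p = 0"
  by (simp add: T_plus_def beta_p)

lemma T_plus_orbit_p: "(T_plus \<beta> \<alpha> ^^ Suc n) p = (T_plus \<beta> \<alpha> ^^ n) 0"
  by (simp only: funpow_Suc_right o_apply T_plus_p)

text \<open>Injectivity of the expansion turns a periodic word into a periodic point. The orbit of
  \<open>p\<close> continues with \<open>0\<close>, so a return to \<open>p\<close> after
  \<open>Suc n\<close> steps is a visit of the orbit of \<open>0\<close> to \<open>p\<close> at time
  \<open>n\<close>.\<close>

lemma periodic_tau_plus_iff: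
  "periodic_word (tau_plus \<beta> \<alpha> p) \<longleftrightarrow> (\<exists>n. (T_plus \<beta> \<alpha> ^^ n) 0 = p)"
proof
  assume "periodic_word (tau_plus \<beta> \<alpha> p)"
  then obtain N where N: "N \<ge> 1" "\<And>i. tau_plus \<beta> \<alpha> p (i + N) = tau_plus \<beta> \<alpha> p i"
    unfolding periodic_word_def by blast
  then have "tau_plus \<beta> \<alpha> ((T_plus \<beta> \<alpha> ^^ N) p) = tau_plus \<beta> \<alpha> p"
    by (simp add: fun_eq_iff tau_plus_shift add.commute)
  then have "(T_plus \<beta> \<alpha> ^^ N) p = p"
    using T_plus_funpow_range[of p N] p_pos p_less_1 by (intro tau_plus_inj) simp_all
  moreover obtain n where "N = Suc n" using \<open>N \<ge> 1\<close> by (cases N) auto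
  ultimately show "\<exists>n. (T_plus \<beta> \<alpha> ^^ n) 0 = p" using T_plus_orbit_p by metis
next
  assume "\<exists>n. (T_plus \<beta> \<alpha> ^^ n) 0 = p"
  then obtain n where n: "(T_plus \<beta> \<alpha> ^^ Suc n) p = p" unfolding T_plus_orbit_p by blast
  have "tau_plus \<beta> \<alpha> p (i + Suc n) = tau_plus \<beta> \<alpha> p i" for i
    using tau_plus_shift[of \<beta> \<alpha> "Suc n" p i] unfolding n by (simp add: add.commute)
  then show "periodic_word (tau_plus \<beta> \<alpha> p)"
    unfolding periodic_word_def by (intro exI[of _ "Suc n"]) simp
qed

text \<open>Either \<open>p\<close> cuts the interval and the new end is the image \<open>0\<close>
  of \<open>p\<close>, or the branch is the one that \<open>T_plus\<close> uses at the old end.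
  Admissibility rules out the letter 0 with an end at or beyond \<open>p\<close>.\<close>

lemma lower_Suc_cases:
  assumes "admissible \<omega> (Suc n)"
  shows "lower \<omega> (Suc n) = 0 \<or> lower \<omega> (Suc n) = T_plus \<beta> \<alpha> (lower \<omega> n)"
proof (cases "\<omega> n = 0")
  case True
  then have "lower \<omega> n < p" using assms by (simp add: admissible_def)
  with True show ?thesis by (simp add: T_plus_branch)
next
  case False
  then show ?thesis
    by (auto simp: T_plus_def branch_def max_def not_le beta_p)
qed

text \<open>The index \<open>i\<close> counts the letters read since a visit to \<open>0\<close>.
  When the count would reach \<open>N\<close>, periodicity puts the end at \<open>0\<close> and the
  count restarts.\<close>

lemma lower_recurs_to_0:
  assumes "(T_plus \<beta> \<alpha> ^^ N) 0 = 0" "0 < N" "admissible \<omega> n"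
  shows "\<exists>i<N. i \<le> n \<and> lower \<omega> (n - i) = 0 \<and> lower \<omega> n = (T_plus \<beta> \<alpha> ^^ i) 0"
  using assms(3)
proof (induction n)
  case 0
  with \<open>0 < N\<close> show ?case by (intro exI[of _ 0]) simp
next
  case (Suc n)
  show ?case
  proof (cases "lower \<omega> (Suc n) = 0")
    case True
    with \<open>0 < N\<close> show ?thesis by (intro exI[of _ 0]) simp
  next
    case False
    obtain i where i: "i < N" "i \<le> n" "lower \<omega> (n - i) = 0" "lower \<omega> n = (T_plus \<beta> \<alpha> ^^ i) 0"
      using Suc admissible_SucD by blast
    have eq: "lower \<omega> (Suc n) = (T_plus \<beta> \<alpha> ^^ Suc i) 0"
      using lower_Suc_cases[OF Suc.prems] False i(4) by simp
    with False assms(1) have "Suc i \<noteq> N" by metis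
    with i eq show ?thesis by (intro exI[of _ "Suc i"]) simp
  qed
qed

text \<open>At one of the last \<open>Suc n\<close> positions the left end for the whole word is
  \<open>0\<close>. The left end for the suffix is squeezed between \<open>0\<close> and it, so the
  two meet there and stay equal.\<close>

lemma lower_determined_by_suffix:
  assumes "periodic_word (tau_plus \<beta> \<alpha> p)"
  shows "\<exists>N. \<forall>\<omega> m M k. N \<le> M \<longrightarrow> M \<le> k \<longrightarrow> admissible \<omega> (m + M) \<longrightarrow>
    lower (suffix m \<omega>) k = lower \<omega> (m + k)"
proof -
  obtain n where "(T_plus \<beta> \<alpha> ^^ n) 0 = p" using assms periodic_tau_plus_iff by blast
  then have N: "(T_plus \<beta> \<alpha> ^^ Suc n) 0 = 0" by (simp add: T_plus_p)
  have "lower (suffix m \<omega>) k = lower \<omega> (m + k)"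
    if M: "Suc n \<le> M" "M \<le> k" "admissible \<omega> (m + M)" for \<omega> m M k
  proof -
    obtain i where i: "i < Suc n" "lower \<omega> (m + M - i) = 0"
      using lower_recurs_to_0[OF N _ M(3)] by blast
    \<comment> \<open>As \<open>i < Suc n\<close> and \<open>Suc n \<le> M\<close>, the visit to
      \<open>0\<close> happens after the first \<open>m\<close> letters, inside the suffix.\<close>
    then have "lower \<omega> (m + (M - i)) = 0" using M(1) by simp
    then have "lower (suffix m \<omega>) (M - i) = lower \<omega> (m + (M - i))"
      using lower_suffix_le[of m \<omega> "M - i"] lower_nonneg[of "suffix m \<omega>" "M - i"] by simp
    then show ?thesis using M(2) by (intro lower_suffix_eq[of m \<omega> "M - i" k]) simp_all
  qed
  then show ?thesis by blast
qed

lemma upper_determined_by_suffix: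
  assumes "periodic_word (tau_minus \<beta> \<alpha> p)"
  shows "\<exists>N. \<forall>\<omega> m M k. N \<le> M \<longrightarrow> M \<le> k \<longrightarrow> admissible \<omega> (m + M) \<longrightarrow>
    upper (suffix m \<omega>) k = upper \<omega> (m + k)"
proof -
  have "periodic_word (tau_plus \<beta> (2 - \<beta> - \<alpha>) (crit_pt \<beta> (2 - \<beta> - \<alpha>)))"
    unfolding tau_plus_reflected by (rule periodic_word_flip[OF assms])
  from intermediate_beta.lower_determined_by_suffix[OF reflected this] obtain N where
    N: "\<And>\<omega> m M k. N \<le> M \<Longrightarrow> M \<le> k \<Longrightarrow>
      intermediate_beta.admissible \<beta> (2 - \<beta> - \<alpha>) \<omega> (m + M) \<Longrightarrow>
      intermediate_beta.lower \<beta> (2 - \<beta> - \<alpha>) (suffix m \<omega>) k =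
      intermediate_beta.lower \<beta> (2 - \<beta> - \<alpha>) \<omega> (m + k)"
    by blast
  have "upper (suffix m \<omega>) k = upper \<omega> (m + k)"
    if "N \<le> M" "M \<le> k" "admissible \<omega> (m + M)" for \<omega> m M k
    using N[of M k "flip \<omega>" m] that
    by (simp add: admissible_reflected lower_reflected flip: flip_suffix)
  then show ?thesis by blast
qed

lemma has_memory_if_periodic:
  assumes "periodic_word (tau_plus \<beta> \<alpha> p)" "periodic_word (tau_minus \<beta> \<alpha> p)"
  shows "\<exists>M. has_memory M"
proof -
  obtain N where N: "\<And>\<omega> m M k. N \<le> M \<Longrightarrow> M \<le> k \<Longrightarrow> admissible \<omega> (m + M) \<Longrightarrow>
      lower (suffix m \<omega>) k = lower \<omega> (m + k)"
    using lower_determined_by_suffix[OF assms(1)] by blast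
  obtain N' where N': "\<And>\<omega> m M k. N' \<le> M \<Longrightarrow> M \<le> k \<Longrightarrow> admissible \<omega> (m + M) \<Longrightarrow>
      upper (suffix m \<omega>) k = upper \<omega> (m + k)"
    using upper_determined_by_suffix[OF assms(2)] by blast
  have "has_memory (max N N')"
    unfolding has_memory_def
  proof (intro allI impI)
    fix \<omega> m n
    assume u: "admissible \<omega> (m + max N N')" and wv: "admissible (suffix m \<omega>) (max N N' + n)"
    show "admissible \<omega> (m + (max N N' + n))"
      using wv N[OF _ _ u, of "max N N' + n"] N'[OF _ _ u, of "max N N' + n"]
      by (simp add: admissible_def)
  qed
  then show ?thesis ..
qed

section \<open>Finite memory forces periodic critical orbits\<close>

text \<open>The letter 1 is read only when the orbit of \<open>0\<close> is at or beyond
  \<open>p\<close>, so the maximum with \<open>p\<close> never changes the end.\<close>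

lemma lower_tau_plus_0: "lower (tau_plus \<beta> \<alpha> 0) n = (T_plus \<beta> \<alpha> ^^ n) 0"
proof (induction n)
  case (Suc n)
  then show ?case
    by (cases "(T_plus \<beta> \<alpha> ^^ n) 0 < p")
      (simp_all add: tau_plus_def T_plus_branch[of "(T_plus \<beta> \<alpha> ^^ n) 0"])
qed simp

text \<open>The gap starts as \<alpha>, the image of \<open>0\<close> under the first letter. Later
  only the maximum with \<open>p\<close> could close it, but on letter 1 the larger end is at least
  \<open>p\<close> and never equal to it.\<close>

lemma lower_suffix_less:
  assumes "\<nexists>n. (T_plus \<beta> \<alpha> ^^ n) 0 = p"
  shows "lower (suffix 1 (tau_plus \<beta> \<alpha> 0)) n < lower (tau_plus \<beta> \<alpha> 0) (1 + n)"
proof (induction n)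
  case 0
  show ?case
    using alpha_pos p_pos by (simp add: branch_def tau_plus_def)
next
  case (Suc n)
  let ?y = "lower (tau_plus \<beta> \<alpha> 0) (1 + n)"
  have y: "?y = (T_plus \<beta> \<alpha> ^^ (1 + n)) 0" by (rule lower_tau_plus_0)
  then have "?y \<noteq> p" using assms by metis
  moreover have "p \<le> ?y" if "tau_plus \<beta> \<alpha> 0 (1 + n) \<noteq> 0"
    using that unfolding y by (auto simp: tau_plus_def split: if_splits)
  ultimately show ?case
    using Suc by (auto simp: suffix_def)
qed

lemma periodic_tau_plus_if_has_memory:
  assumes M: "has_memory M"
  shows "periodic_word (tau_plus \<beta> \<alpha> p)"
proof (rule ccontr)
  assume "\<not> periodic_word (tau_plus \<beta> \<alpha> p)"
  then have nonper: "\<nexists>n. (T_plus \<beta> \<alpha> ^^ n) 0 = p" by (simp add: periodic_tau_plus_iff)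
  define a where "a = tau_plus \<beta> \<alpha> 0"
  have bin_a: "binary_word a" by (simp add: a_def)
  have adm_a: "admissible a n" for n unfolding a_def by (rule tau_plus_admissible) simp_all
  define l where "l = lower (suffix 1 a) M"
  define L where "L = lower a (1 + M)"
  have "l < L" unfolding l_def L_def a_def by (rule lower_suffix_less[OF nonper])
  have L: "L < 1" using lower_tau_plus_0[of "1 + M"] T_plus_funpow_range[of 0 "1 + M"]
    by (simp add: L_def a_def)
  have l: "0 \<le> l" "l < 1" using \<open>l < L\<close> L lower_nonneg by (simp_all add: l_def)
  \<comment> \<open>Points at distance at least \<open>L - l\<close> cannot share their first
    \<open>n\<close> digits.\<close>
  obtain n where n: "1 < \<beta> ^ n * (L - l)" using beta_power_large[of "L - l"] \<open>l < L\<close> by auto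
  define b where "b = tau_plus \<beta> \<alpha> l"
  \<comment> \<open>The first \<open>1 + M\<close> letters of \<open>a\<close> are continued by the
    code of \<open>l\<close>, a point left of every image reachable along these letters, but
    reachable once the first letter is forgotten.\<close>
  define \<omega> where "\<omega> = (\<lambda>i. if i < 1 + M then a i else b (i - (1 + M)))"
  have bin: "binary_word \<omega>" by (auto simp: \<omega>_def a_def b_def binary_word_def tau_plus_def)
  have "admissible \<omega> (1 + M)"
    using admissible_cong[of "1 + M" \<omega> a] adm_a by (simp add: \<omega>_def)
  moreover have suf: "suffix (1 + M) \<omega> = b" by (simp add: suffix_def \<omega>_def)
  then have "admissible (suffix (1 + M) \<omega>) n"
    using l by (simp add: b_def tau_plus_admissible)
  moreover have "admissible (suffix 1 \<omega>) (M + n)"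
  proof -
    \<comment> \<open>\<open>x\<close> is the leftmost point coded by these \<open>M\<close>
      letters; its image is exactly \<open>l\<close>, so its expansion is all of
      \<open>suffix 1 \<omega>\<close>.\<close>
    obtain x where x: "follow (suffix 1 a) M x = l" using follow_surj by blast
    moreover have "admissible (suffix 1 a) M" using adm_a by (rule admissible_suffix)
    ultimately have x01: "0 \<le> x" "x < 1" and agree: "\<forall>i<M. tau_plus \<beta> \<alpha> x i = suffix 1 a i"
      using tau_plus_prefix_iff[OF binary_suffix[OF bin_a, of 1], of x M]
      by (auto simp: l_def admissible_def)
    have Tx: "(T_plus \<beta> \<alpha> ^^ M) x = l"
      using follow_tau_plus[of M x "suffix 1 a"] agree x by simp
    have "tau_plus \<beta> \<alpha> x i = suffix 1 \<omega> i" for i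
    proof (cases "i < M")
      case True
      then show ?thesis using agree by (simp add: suffix_def \<omega>_def)
    next
      case False
      then show ?thesis
        using tau_plus_shift[of \<beta> \<alpha> M x "i - M"] Tx by (simp add: suffix_def \<omega>_def b_def)
    qed
    then have "suffix 1 \<omega> = tau_plus \<beta> \<alpha> x" by auto
    then show ?thesis using x01 by (simp add: tau_plus_admissible)
  qed
  ultimately have "admissible \<omega> (1 + (M + n))"
    using M bin unfolding has_memory_def by blast
  then obtain y where y: "0 \<le> y" "y < 1" and agree: "\<forall>i<1 + (M + n). tau_plus \<beta> \<alpha> y i = \<omega> i"
    using admissible_iff_tau_plus[OF bin] by blast
  \<comment> \<open>The contradiction comes from \<open>z\<close>: it has passed through the image
    interval with left end \<open>L\<close>, yet shares \<open>n\<close> digits with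
    \<open>l\<close>.\<close>
  define z where "z = (T_plus \<beta> \<alpha> ^^ (1 + M)) y"
  have "follow \<omega> (1 + M) y = z"
    unfolding z_def using agree by (intro follow_tau_plus) simp
  moreover have "lower \<omega> (1 + M) \<le> follow \<omega> (1 + M) y"
    using tau_plus_prefix_iff[OF bin, of y "1 + M"] y agree by simp
  moreover have "lower \<omega> (1 + M) = L"
    unfolding L_def by (rule lower_cong) (simp add: \<omega>_def)
  ultimately have "L \<le> z" by simp
  have z: "0 \<le> z" "z < 1" using T_plus_funpow_range[OF y, of "1 + M"] by (simp_all add: z_def)
  have "tau_plus \<beta> \<alpha> z i = tau_plus \<beta> \<alpha> l i" if "i < n" for i
  proof -
    have "tau_plus \<beta> \<alpha> z i = \<omega> (1 + M + i)"
      using agree that unfolding z_def tau_plus_shift by simp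
    also have "\<dots> = b i" by (simp add: \<omega>_def)
    finally show ?thesis by (simp add: b_def)
  qed
  then have "\<beta> ^ n * \<bar>z - l\<bar> < 1" using tau_plus_agree_dist[OF z l] by blast
  moreover have "\<beta> ^ n * (L - l) \<le> \<beta> ^ n * \<bar>z - l\<bar>"
    using \<open>L \<le> z\<close> beta_gt_1 by (intro mult_left_mono) auto
  ultimately show False using n by simp
qed

lemma periodic_tau_minus_if_has_memory:
  assumes "has_memory M"
  shows "periodic_word (tau_minus \<beta> \<alpha> p)"
proof -
  have "intermediate_beta.has_memory \<beta> (2 - \<beta> - \<alpha>) M" using assms by (simp add: has_memory_reflected)
  then have "periodic_word (tau_plus \<beta> (2 - \<beta> - \<alpha>) (crit_pt \<beta> (2 - \<beta> - \<alpha>)))"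
    by (rule intermediate_beta.periodic_tau_plus_if_has_memory[OF reflected])
  from periodic_word_flip[OF this] show ?thesis
    unfolding tau_plus_reflected by (simp add: flip_flip)
qed

end

theorem theorem1p3:
  fixes \<beta> \<alpha> p :: real
  assumes "\<beta> \<in> {1<..<2}" and "\<alpha> \<in> {0<..<2 - \<beta>}" and "p = (1 - \<alpha>) / \<beta>"
  shows "subshift_of_finite_type (Omega \<beta> \<alpha>) \<longleftrightarrow>
    periodic_word (tau_plus \<beta> \<alpha> p) \<and> periodic_word (tau_minus \<beta> \<alpha> p)"
proof -
  interpret intermediate_beta \<beta> \<alpha>
    using assms(1,2) by unfold_locales auto
  have "p = crit_pt \<beta> \<alpha>" using assms(3) by (simp add: crit_pt_def)
  then show ?thesis
    unfolding subshift_of_finite_type_iff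
    using has_memory_if_periodic periodic_tau_plus_if_has_memory periodic_tau_minus_if_has_memory
    by blast
qed

end
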